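(* Let $p$ be an odd prime, let $S$ be an $n\times n$ matrix over $\mathbb{F}_p$, and let $U$ be an $S$-invariant subspace of $\mathbb{F}_p^n$. Then $U^\perp$ is $S^{\mathrm T}$-invariant, and \[ \chi(S;x)=\chi(S|_U;x)\,\chi(S^{\mathrm T}|_{U^\perp};x). \]
   Context: For a subspace $U\subseteq\mathbb{F}_p^n$, $U^\perp=\{u\in\mathbb{F}_p^n : v^{\mathrm T}u=0\text{ for every }v\in U\}$ is its orthogonal space with respect to the standard bilinear form (note $U\cap U^\perp$ may be nonzero). $\chi(\cdot;x)$ denotes the characteristic polynomial $\det(xI-\cdot)$ of a matrix or linear operator (equal to $1$ on the zero space), and $S|_U$ is the restriction to $U$ of the operator $v\mapsto Sv$. *)

theory Defs
  imports
    "Jordan_Normal_Form.Char_Poly"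
    "Jordan_Normal_Form.DL_Rank"
    "Berlekamp_Zassenhaus.Finite_Field"
begin

context vec_space
begin

definition ordered_basis :: "'a vec set \<Rightarrow> 'a vec list \<Rightarrow> bool" where
  "ordered_basis U bs \<longleftrightarrow> distinct bs \<and> vectorspace.basis class_ring (vs U) (set bs)"

definition operator_matrix :: "('a vec \<Rightarrow> 'a vec) \<Rightarrow> 'a vec list \<Rightarrow> 'a mat \<Rightarrow> bool" where
  "operator_matrix T bs A \<longleftrightarrow> A \<in> carrier_mat (length bs) (length bs) \<and>
     (\<forall>j < length bs. T (bs ! j) = lincomb_list (\<lambda>i. A $$ (i, j)) bs)"

text \<open>The characteristic polynomial of the restriction of \<^term>\<open>T\<close> to \<^term>\<open>U\<close>: that of the
  matrix of \<^term>\<open>T\<close> with respect to any basis of \<^term>\<open>U\<close>. The description is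
  meaningful when \<^term>\<open>T\<close> is linear and maps the subspace \<^term>\<open>U\<close> into itself; for
  multiplication by a matrix this is \<open>char_poly_on_eq\<close> together with
  \<open>operator_matrix_exists\<close> below.\<close>

definition char_poly_on :: "'a vec set \<Rightarrow> ('a vec \<Rightarrow> 'a vec) \<Rightarrow> 'a poly" where
  "char_poly_on U T =
     (THE f. \<exists>bs A. ordered_basis U bs \<and> operator_matrix T bs A \<and> f = char_poly A)"

context
  fixes U :: "'a vec set"
  assumes U: "VectorSpace.subspace class_ring U V"
begin

lemma subspace_vs: "vectorspace class_ring (vs U)"
  using subspace_is_vs[OF U] .

lemma subspace_submodule: "submodule class_ring U V"
  using U by (simp add: subspace_def)

lemma subspace_carrier: "U \<subseteq> carrier_vec n"
  using submodule.subset[OF subspace_submodule] by simp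

lemma ordered_basis_iff:
  "ordered_basis U bs \<longleftrightarrow> distinct bs \<and> set bs \<subseteq> U \<and> lin_indpt (set bs) \<and> span (set bs) = U"
proof (cases "set bs \<subseteq> U")
  case True
  show ?thesis
    unfolding ordered_basis_def vectorspace.basis_def[OF subspace_vs]
      span_li_not_depend[OF True subspace_submodule] carrier_vs_is_self
    using True by blast
next
  case False
  then show ?thesis
    unfolding ordered_basis_def vectorspace.basis_def[OF subspace_vs] carrier_vs_is_self
    by blast
qed

lemma ordered_basis_exists: "\<exists>bs. ordered_basis U bs"
proof -
  have "\<exists>B. finite B \<and> maximal B (\<lambda>T. T \<subseteq> U \<and> lin_indpt T)"
  proof (rule maximal_exists[where N = n and B = "{}"])
    fix A assume "A \<subseteq> U \<and> lin_indpt A"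
    then show "finite A \<and> card A \<le> n"
      using subspace_carrier li_le_dim[OF fin_dim, of A] by (auto simp: dim_is_n)
  next
    show "{} \<subseteq> U \<and> lin_indpt {}" by (auto simp: lin_dep_def)
  qed
  then obtain B where B: "finite B" "maximal B (\<lambda>T. T \<subseteq> U \<and> lin_indpt T)" by blast
  have eq: "T \<subseteq> carrier (vs U) \<and> \<not> LinearCombinations.module.lin_dep class_ring (vs U) T
      \<longleftrightarrow> T \<subseteq> U \<and> lin_indpt T" for T
  proof (cases "T \<subseteq> U")
    case True
    show ?thesis using span_li_not_depend(2)[OF True subspace_submodule] by simp
  qed simp
  have "vectorspace.basis class_ring (vs U) B"
    by (rule vectorspace.max_li_is_basis[OF subspace_vs]) (use B(2) in \<open>simp only: eq\<close>)
  moreover obtain bs where "set bs = B" "distinct bs"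
    using finite_distinct_list[OF B(1)] by blast
  ultimately show ?thesis unfolding ordered_basis_def by blast
qed

context
  fixes bs
  assumes bs: "ordered_basis U bs"
begin

lemma ordered_basis_carrier: "set bs \<subseteq> carrier_vec n"
  using bs subspace_carrier by (auto simp: ordered_basis_iff)

lemma ordered_basis_coords:
  assumes u: "u \<in> U"
  shows "\<exists>c \<in> carrier_vec (length bs). mat_of_cols n bs *\<^sub>v c = u"
proof -
  have "u \<in> span (set bs)" using u bs by (simp add: ordered_basis_iff)
  then obtain a where "lincomb a (set bs) = u"
    using finite_in_span[OF _ ordered_basis_carrier] by (metis List.finite_set)
  moreover have "lincomb a (set bs) = lincomb_list (\<lambda>i. a (bs ! i)) bs"
    using bs by (intro lincomb_as_lincomb_list_distinct ordered_basis_carrier)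
      (simp add: ordered_basis_def)
  moreover have "\<dots> = mat_of_cols n bs *\<^sub>v vec (length bs) (\<lambda>i. a (bs ! i))"
    using ordered_basis_carrier by (intro lincomb_list_as_mat_mult) auto
  ultimately show ?thesis by (intro bexI[of _ "vec (length bs) (\<lambda>i. a (bs ! i))"]) auto
qed

lemma ordered_basis_inj:
  assumes c: "c \<in> carrier_vec (length bs)" and 0: "mat_of_cols n bs *\<^sub>v c = 0\<^sub>v n"
  shows "c = 0\<^sub>v (length bs)"
proof (rule eq_vecI)
  have d: "distinct bs" and li: "lin_indpt (set bs)" using bs by (auto simp: ordered_basis_iff)
  define a where "a v = (\<Sum>i\<in>{0..<length bs}. if v = bs ! i then c $ i else 0)" for v
  have a: "a (bs ! i) = c $ i" if "i < length bs" for i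
  proof -
    have "a (bs ! i) = (\<Sum>j\<in>{0..<length bs}. if j = i then c $ j else 0)"
      unfolding a_def using that d by (intro sum.cong) (auto simp: nth_eq_iff_index_eq)
    also have "\<dots> = c $ i" using that by simp
    finally show ?thesis .
  qed
  have "lincomb a (set bs) = mat_of_cols n bs *\<^sub>v c"
    unfolding a_def[abs_def] using ordered_basis_carrier nth_mem
    by (intro mat_of_cols_mult_as_finsum[OF c, symmetric]) blast
  then have "lincomb a (set bs) = 0\<^sub>v n" using 0 by simp
  then have z: "a v = 0" if "v \<in> set bs" for v
    using li that unfolding lin_dep_def by (metis List.finite_set subset_refl)
  show "c $ i = 0\<^sub>v (length bs) $ i" if "i < dim_vec (0\<^sub>v (length bs))" for i
    using that a[of i] z[of "bs ! i"] by simp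
qed (use c in simp)

lemma operator_matrix_mat_iff:
  assumes S: "S \<in> carrier_mat n n"
  shows "operator_matrix ((*\<^sub>v) S) bs A \<longleftrightarrow>
    A \<in> carrier_mat (length bs) (length bs) \<and> S * mat_of_cols n bs = mat_of_cols n bs * A"
    (is "_ \<longleftrightarrow> ?c \<and> _")
proof (cases ?c)
  case A: True
  let ?B = "mat_of_cols n bs"
  have B: "?B \<in> carrier_mat n (length bs)" by simp
  have l: "lincomb_list (\<lambda>i. A $$ (i, j)) bs = ?B *\<^sub>v col A j" if "j < length bs" for j
  proof -
    have "col A j = vec (length bs) (\<lambda>i. A $$ (i, j))" using A that by (auto simp: col_def)
    then show ?thesis
      using lincomb_list_as_mat_mult[of bs "\<lambda>i. A $$ (i, j)"] ordered_basis_carrier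
      by (metis carrier_vecD subsetD)
  qed
  have c1: "col (S * ?B) j = S *\<^sub>v (bs ! j)" if "j < length bs" for j
    using col_mult2[OF S B that] col_mat_of_cols[of j bs n] that ordered_basis_carrier nth_mem
    by (metis subsetD)
  have c2: "col (?B * A) j = ?B *\<^sub>v col A j" if "j < length bs" for j
    using col_mult2[OF B A that] .
  have "S * ?B = ?B * A \<longleftrightarrow> (\<forall>j < length bs. col (S * ?B) j = col (?B * A) j)"
    using S A by (auto intro!: mat_col_eqI)
  then show ?thesis using A l c1 c2 unfolding operator_matrix_def by auto
qed (auto simp: operator_matrix_def)

lemma ordered_basis_coords_mat:
  assumes X: "X \<in> carrier_mat n k" and cols: "\<And>j. j < k \<Longrightarrow> col X j \<in> U"
  shows "\<exists>P \<in> carrier_mat (length bs) k. X = mat_of_cols n bs * P"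
proof -
  let ?B = "mat_of_cols n bs"
  have B: "?B \<in> carrier_mat n (length bs)" by simp
  obtain c where c: "\<And>j. j < k \<Longrightarrow> c j \<in> carrier_vec (length bs) \<and> ?B *\<^sub>v c j = col X j"
    using ordered_basis_coords[OF cols] by metis
  let ?P = "mat_of_cols (length bs) (map c [0..<k])"
  have P: "?P \<in> carrier_mat (length bs) k" by (simp add: mat_of_cols_def)
  have "X = ?B * ?P"
  proof (rule mat_col_eqI)
    fix j assume "j < dim_col (?B * ?P)"
    then have j: "j < k" using P by simp
    have "col ?P j = c j" using c j by (subst col_mat_of_cols) auto
    then show "col X j = col (?B * ?P) j" using col_mult2[OF B P j] c[OF j] by simp
  qed (use X P in auto)
  then show ?thesis using P by blast
qed

lemma operator_matrix_exists:
  assumes S: "S \<in> carrier_mat n n" and inv: "\<And>v. v \<in> U \<Longrightarrow> S *\<^sub>v v \<in> U"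
  shows "\<exists>A. operator_matrix ((*\<^sub>v) S) bs A"
proof -
  let ?B = "mat_of_cols n bs"
  have B: "?B \<in> carrier_mat n (length bs)" by simp
  have "col (S * ?B) j \<in> U" if j: "j < length bs" for j
  proof -
    have "bs ! j \<in> U" using bs j by (auto simp: ordered_basis_iff)
    then show ?thesis
      using inv col_mult2[OF S B j] col_mat_of_cols[of j bs n] j subspace_carrier
      by (metis subsetD)
  qed
  then obtain A where "A \<in> carrier_mat (length bs) (length bs)" "S * ?B = ?B * A"
    using ordered_basis_coords_mat[OF mult_carrier_mat[OF S B]] by blast
  then show ?thesis using operator_matrix_mat_iff[OF S] by blast
qed

lemma ordered_basis_cancel:
  assumes X: "X \<in> carrier_mat (length bs) k" and Y: "Y \<in> carrier_mat (length bs) k"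
    and eq: "mat_of_cols n bs * X = mat_of_cols n bs * Y"
  shows "X = Y"
proof (rule mat_col_eqI)
  let ?B = "mat_of_cols n bs"
  have B: "?B \<in> carrier_mat n (length bs)" by simp
  fix j assume "j < dim_col Y"
  then have j: "j < k" using Y by simp
  have cX: "col X j \<in> carrier_vec (length bs)" and cY: "col Y j \<in> carrier_vec (length bs)"
    using X Y j by auto
  have "?B *\<^sub>v col X j = ?B *\<^sub>v col Y j"
    using col_mult2[OF B X j] col_mult2[OF B Y j] eq by simp
  then have "?B *\<^sub>v (col X j - col Y j) = 0\<^sub>v n"
    using mult_minus_distrib_mat_vec[OF B cX cY] mult_mat_vec_carrier[OF B cY] by simp
  then have z: "col X j - col Y j = 0\<^sub>v (length bs)" using cX cY by (intro ordered_basis_inj) auto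
  show "col X j = col Y j"
  proof (rule eq_vecI)
    fix i assume "i < dim_vec (col Y j)"
    then have i: "i < length bs" using cY by (metis carrier_vecD)
    have "(col X j - col Y j) $ i = 0" unfolding z using i by simp
    then show "col X j $ i = col Y j $ i" using i cX cY by (metis carrier_vecD index_minus_vec(1) eq_iff_diff_eq_0)
  qed (use X Y in auto)
qed (use X Y in auto)

end

lemma operator_matrix_char_poly_unique:
  assumes S: "S \<in> carrier_mat n n"
    and bs: "ordered_basis U bs" "operator_matrix ((*\<^sub>v) S) bs A"
    and cs: "ordered_basis U cs" "operator_matrix ((*\<^sub>v) S) cs C"
  shows "char_poly A = char_poly C"
proof -
  let ?B = "mat_of_cols n bs" and ?C = "mat_of_cols n cs"
  let ?k = "length bs" and ?l = "length cs"
  have B: "?B \<in> carrier_mat n ?k" and C: "?C \<in> carrier_mat n ?l" by simp_all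
  have col: "col (mat_of_cols n ds) j \<in> U" if "ordered_basis U ds" "j < length ds" for ds j
  proof -
    have "ds ! j \<in> U" using that by (auto simp: ordered_basis_iff)
    then show ?thesis using col_mat_of_cols[of j ds n] that subspace_carrier by (metis subsetD)
  qed
  obtain P where P: "P \<in> carrier_mat ?k ?l" "?C = ?B * P"
    using ordered_basis_coords_mat[OF bs(1) C col[OF cs(1)]] by blast
  obtain Q where Q: "Q \<in> carrier_mat ?l ?k" "?B = ?C * Q"
    using ordered_basis_coords_mat[OF cs(1) B col[OF bs(1)]] by blast
  have A: "A \<in> carrier_mat ?k ?k" "S * ?B = ?B * A"
    using bs operator_matrix_mat_iff[OF bs(1) S] by auto
  have C': "C \<in> carrier_mat ?l ?l" "S * ?C = ?C * C"
    using cs operator_matrix_mat_iff[OF cs(1) S] by auto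
  have PQ: "P * Q = 1\<^sub>m ?k"
  proof (rule ordered_basis_cancel[OF bs(1)])
    have "?B * (P * Q) = ?C * Q" unfolding P(2) using assoc_mult_mat[OF B P(1) Q(1)] by (rule sym)
    also have "\<dots> = ?B * 1\<^sub>m ?k" unfolding right_mult_one_mat[OF B] by (rule Q(2)[symmetric])
    finally show "?B * (P * Q) = ?B * 1\<^sub>m ?k" .
  qed (use P(1) Q(1) in auto)
  have QP: "Q * P = 1\<^sub>m ?l"
  proof (rule ordered_basis_cancel[OF cs(1)])
    have "?C * (Q * P) = ?C * Q * P" using assoc_mult_mat[OF C Q(1) P(1)] by (rule sym)
    also have "\<dots> = ?B * P" by (rule arg_cong[OF Q(2)[symmetric]])
    also have "\<dots> = ?C * 1\<^sub>m ?l" unfolding right_mult_one_mat[OF C] by (rule P(2)[symmetric])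
    finally show "?C * (Q * P) = ?C * 1\<^sub>m ?l" .
  qed (use P(1) Q(1) in auto)
  have kl: "?k = ?l"
  proof -
    have b: "vectorspace.basis class_ring (vs U) (set ds)" if "ordered_basis U ds" for ds
      using that by (simp add: ordered_basis_def)
    have "card (set bs) = card (set cs)"
      by (rule trans[OF sym[OF vectorspace.dim_basis[OF subspace_vs List.finite_set b[OF bs(1)]]]
            vectorspace.dim_basis[OF subspace_vs List.finite_set b[OF cs(1)]]])
    then show ?thesis using bs(1) cs(1) by (simp add: ordered_basis_def distinct_card)
  qed
  have "A * P = P * C"
  proof (rule ordered_basis_cancel[OF bs(1)])
    have "?B * (A * P) = S * ?B * P" unfolding A(2) by (rule assoc_mult_mat[OF B A(1) P(1), symmetric])
    also have "\<dots> = S * ?C" unfolding P(2) by (rule assoc_mult_mat[OF S B P(1)])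
    also have "\<dots> = ?B * P * C" unfolding C'(2) unfolding P(2) ..
    also have "\<dots> = ?B * (P * C)" by (rule assoc_mult_mat[OF B P(1) C'(1)])
    finally show "?B * (A * P) = ?B * (P * C)" .
  qed (use A(1) P(1) C'(1) in auto)
  then have "P * C * Q = A * (P * Q)" using assoc_mult_mat[OF A(1) P(1) Q(1)] by simp
  then have "A = P * C * Q" unfolding PQ right_mult_one_mat[OF A(1)] by (rule sym)
  then have "similar_mat_wit A C P Q"
    using A(1) C'(1) P(1) Q(1) PQ QP kl unfolding similar_mat_wit_def by (simp add: Let_def)
  then have "similar_mat A C" unfolding similar_mat_def by blast
  then show ?thesis by (rule char_poly_similar)
qed

lemma char_poly_on_eq:
  assumes "S \<in> carrier_mat n n" "ordered_basis U bs" "operator_matrix ((*\<^sub>v) S) bs A"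
  shows "char_poly_on U ((*\<^sub>v) S) = char_poly A"
  unfolding char_poly_on_def
proof (rule the_equality)
  fix f assume "\<exists>bs A. ordered_basis U bs \<and> operator_matrix ((*\<^sub>v) S) bs A \<and> f = char_poly A"
  then obtain cs C where "ordered_basis U cs" "operator_matrix ((*\<^sub>v) S) cs C" "f = char_poly C"
    by blast
  then show "f = char_poly A"
    using operator_matrix_char_poly_unique[OF assms(1) _ _ assms(2,3)] by simp
qed (use assms(2,3) in blast)

end

end

end

theory Submission
  imports Defs
begin

text \<open>Extend a basis of \<open>U\<close> to a basis of the whole space and let \<open>M\<close> be the invertible matrix with
  these columns. Then \<open>M\<^sup>-\<^sup>1 S M\<close> is block upper triangular with diagonal blocks \<open>A\<close> and \<open>D\<close>, where
  \<open>A\<close> represents \<open>S\<close> on \<open>U\<close>. The last columns of the inverse transpose of \<open>M\<close> form a basis of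
  \<open>U\<^sup>\<bottom>\<close>, and transposing the block form shows that \<open>S\<^sup>T\<close> is represented there by \<open>D\<^sup>T\<close>.\<close>

text \<open>Subtracting the matrix from x times the identity keeps the zero block, so the
  determinant formula for block triangular matrices applies over the polynomial ring.\<close>

lemma char_poly_four_block_lower_left_zero:
  fixes A :: "'a :: idom mat"
  assumes A: "A \<in> carrier_mat k k" and B: "B \<in> carrier_mat k m" and D: "D \<in> carrier_mat m m"
  shows "char_poly (four_block_mat A B (0\<^sub>m m k) D) = char_poly A * char_poly D"
proof -
  have "char_poly_matrix (four_block_mat A B (0\<^sub>m m k) D) =
      four_block_mat (char_poly_matrix A) (map_mat (\<lambda>a. [:- a:]) B) (0\<^sub>m m k) (char_poly_matrix D)"
    by (rule eq_matI) (use A B D in \<open>auto simp: char_poly_matrix_def\<close>)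
  then show ?thesis
    unfolding char_poly_def
    by (subst det_four_block_mat_lower_left_zero[symmetric]) (use A B D in auto)
qed

context vec_space
begin

text \<open>Independent sets have at most \<open>n\<close> elements, so a maximal one containing
  \<open>set bs\<close> exists; it turns out to be a basis of the whole space, and listing
  \<open>bs\<close> first fixes the order that the block form needs.\<close>

lemma ordered_basis_extend:
  assumes U: "VectorSpace.subspace class_ring U V" and bs: "ordered_basis U bs"
  shows "\<exists>cs. ordered_basis (carrier_vec n) (bs @ cs) \<and> length (bs @ cs) = n"
proof -
  let ?P = "\<lambda>T. T \<subseteq> carrier_vec n \<and> lin_indpt T"
  let ?Q = "\<lambda>T. set bs \<subseteq> T \<and> ?P T"
  have li: "lin_indpt (set bs)" and "distinct bs"
    using bs ordered_basis_iff[OF U] by auto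
  have "\<exists>B. finite B \<and> maximal B ?Q"
    by (rule maximal_exists[where N = n and B = "set bs"])
      (use li_le_dim[OF fin_dim] li ordered_basis_carrier[OF U bs] in \<open>auto simp: dim_is_n\<close>)
  then obtain B where B: "finite B" "maximal B ?Q" by blast
  then have sub: "set bs \<subseteq> B" by (auto simp: maximal_def)
  \<comment> \<open>Any independent superset of \<open>B\<close> still contains
    \<open>set bs\<close>, so it already competes in \<open>?Q\<close>.\<close>
  have "maximal B ?P" using B(2) unfolding maximal_def by (meson subset_trans)
  then have basis: "basis B" using max_li_is_basis by simp
  obtain cs where cs: "set cs = B - set bs" "distinct cs"
    using finite_distinct_list[of "B - set bs"] B(1) by blast
  have set: "set (bs @ cs) = B" and dist: "distinct (bs @ cs)"
    using sub cs \<open>distinct bs\<close> by auto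
  have "length (bs @ cs) = n"
    using distinct_card[OF dist] set dim_basis[OF B(1) basis] dim_is_n by simp
  moreover have "vs (carrier_vec n) = V" by (simp add: module_vec_def)
  ultimately show ?thesis
    using dist basis set unfolding ordered_basis_def by metis
qed

lemma subspace_carrier_vec: "VectorSpace.subspace class_ring (carrier_vec n) V"
  using span_is_subspace[OF unit_vecs_carrier] unfolding span_unit_vecs_is_carrier .

text \<open>A left inverse makes \<open>Q\<close> injective, which gives independence. Distinctness
  is a separate point because a set of columns forgets repetitions: equal columns would be sent by
  \<open>L\<close> to equal unit vectors.\<close>

lemma ordered_basis_cols:
  assumes Q: "Q \<in> carrier_mat n m" and L: "L \<in> carrier_mat m n" and LQ: "L * Q = 1\<^sub>m m"
  shows "ordered_basis (col_space Q) (cols Q)"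
proof -
  have sub: "set (cols Q) \<subseteq> carrier_vec n" using cols_dim Q by blast
  have "distinct (cols Q)"
  proof (unfold distinct_conv_nth, intro allI impI notI)
    fix i j assume *: "i < length (cols Q)" "j < length (cols Q)" "i \<noteq> j" "cols Q ! i = cols Q ! j"
    then have ij: "i < m" "j < m" using Q by auto
    have "col (L * Q) i = col (L * Q) j" using * ij col_mult2[OF L Q] Q by simp
    then have "unit_vec m i = (unit_vec m j :: 'a vec)" unfolding LQ using ij by simp
    then show False using ij *(3) by (metis index_unit_vec(1) zero_neq_one)
  qed
  moreover have "lin_indpt (set (cols Q))"
  proof
    assume "lin_dep (set (cols Q))"
    then obtain v where v: "v \<in> carrier_vec m" "v \<noteq> 0\<^sub>v m" "Q *\<^sub>v v = 0\<^sub>v n"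
      using lin_depE[OF Q _ \<open>distinct (cols Q)\<close>] by metis
    have "v = (L * Q) *\<^sub>v v" using LQ v by simp
    also have "\<dots> = L *\<^sub>v (Q *\<^sub>v v)" using assoc_mult_mat_vec[OF L Q v(1)] .
    also have "\<dots> = 0\<^sub>v m" using v(3) L by auto
    finally show False using v(2) by blast
  qed
  moreover have "set (cols Q) \<subseteq> span (set (cols Q))" using in_own_span[OF sub] .
  ultimately show ?thesis
    unfolding col_space_def using ordered_basis_iff[OF span_is_subspace[OF sub]] by blast
qed

text \<open>Moving the transpose across the scalar product turns a test against \<open>y\<close>
  into a test against \<open>S *\<^sub>v y\<close>, which is again in \<open>U\<close>.\<close>

lemma orthogonal_complement_transpose_invariant:
  fixes S :: "'a mat"
  assumes S: "S \<in> carrier_mat n n" and U: "U \<subseteq> carrier_vec n"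
    and inv: "\<And>v. v \<in> U \<Longrightarrow> S *\<^sub>v v \<in> U" and v: "v \<in> orthogonal_complement U"
  shows "S\<^sup>T *\<^sub>v v \<in> orthogonal_complement U"
proof -
  have vc: "v \<in> carrier_vec n" using v by (simp add: orthogonal_complement_def)
  have "(S\<^sup>T *\<^sub>v v) \<bullet> y = 0" if y: "y \<in> U" for y
  proof -
    have yc: "y \<in> carrier_vec n" using y U by blast
    have "(S\<^sup>T *\<^sub>v v) \<bullet> y = v \<bullet> (S *\<^sub>v y)"
      using transpose_vec_mult_scalar[OF S yc vc] .
    then show ?thesis using v inv[OF y] by (simp add: orthogonal_complement_def)
  qed
  then show ?thesis using S vc by (simp add: orthogonal_complement_def)
qed

lemma char_poly_restrict_orthogonal_complement:
  assumes S: "S \<in> carrier_mat n n" and U: "VectorSpace.subspace class_ring U V"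
    and inv: "\<And>v. v \<in> U \<Longrightarrow> S *\<^sub>v v \<in> U"
  shows "char_poly S =
    char_poly_on U ((*\<^sub>v) S) * char_poly_on (orthogonal_complement U) ((*\<^sub>v) S\<^sup>T)"
proof -
  obtain bs where bs: "ordered_basis U bs" using ordered_basis_exists[OF U] by blast
  obtain cs where es: "ordered_basis (carrier_vec n) (bs @ cs)" and len: "length (bs @ cs) = n"
    using ordered_basis_extend[OF U bs] by blast
  define k m where "k = length bs" and "m = length cs"
  have n: "n = k + m" using len by (simp add: k_def m_def)
  obtain A where opA: "operator_matrix ((*\<^sub>v) S) bs A"
    using operator_matrix_exists[OF U bs S inv] by blast
  define M1 where "M1 = mat_of_cols n bs"
  define M where "M = mat_of_cols n (bs @ cs)"
  have M1: "M1 \<in> carrier_mat n k" by (simp add: M1_def k_def)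
  have M: "M \<in> carrier_mat n n" using len unfolding M_def by (metis mat_of_cols_carrier(1))
  have A: "A \<in> carrier_mat k k" and SM1: "S * M1 = M1 * A"
    using opA operator_matrix_mat_iff[OF U bs S] by (auto simp: M1_def k_def)
  \<comment> \<open>The columns of \<open>N\<close> are the coordinates of the standard unit vectors
    in the extended basis.\<close>
  obtain N where N: "N \<in> carrier_mat n n" and MN: "M * N = 1\<^sub>m n"
    using ordered_basis_coords_mat[OF subspace_carrier_vec es one_carrier_mat] len
    by (fastforce simp: M_def)
  have NM: "N * M = 1\<^sub>m n" using mat_mult_left_right_inverse[OF M N MN] .
  \<comment> \<open>\<open>C\<close> is the matrix of \<open>S\<close> in the extended
    basis.\<close>
  define C where "C = N * S * M"
  have C: "C \<in> carrier_mat n n" using N S M by (simp add: C_def)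
  have MC: "M * C = S * M"
    using assoc_mult_mat[OF M mult_carrier_mat[OF N S] M] assoc_mult_mat[OF M N S] MN S
    by (simp add: C_def)
  \<comment> \<open>Right multiplication by \<open>E\<close> selects the first \<open>k\<close>
    columns, by \<open>F\<close> the last \<open>m\<close>; block statements thus become matrix
    equations.\<close>
  define E F :: "'a mat" where "E = mat n k (\<lambda>(i, j). if i = j then 1 else 0)"
    and "F = mat n m (\<lambda>(i, j). if i = j + k then 1 else 0)"
  have E: "E \<in> carrier_mat n k" and F: "F \<in> carrier_mat n m" by (simp_all add: E_def F_def)
  have mult_E: "(X * E) $$ (i, j) = X $$ (i, j)"
    if "X \<in> carrier_mat r n" "i < r" "j < k" for X r i j
    using that n by (simp add: E_def scalar_prod_def sum.delta if_distrib cong: if_cong)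
  have mult_F: "(X * F) $$ (i, j) = X $$ (i, j + k)"
    if "X \<in> carrier_mat r n" "i < r" "j < m" for X r i j
    using that n by (simp add: F_def scalar_prod_def sum.delta if_distrib cong: if_cong)
  have ME: "M * E = M1"
  proof (rule eq_matI)
    fix i j assume "i < dim_row M1" "j < dim_col M1"
    then have "i < n" "j < k" using M1 by auto
    then show "(M * E) $$ (i, j) = M1 $$ (i, j)"
      using mult_E[OF M] n by (simp add: M_def M1_def mat_of_cols_def nth_append k_def m_def)
  qed (use M E M1 in auto)
  \<comment> \<open>Both sides equal \<open>S * M1\<close>. Cancelling \<open>M\<close> shows that
    the first \<open>k\<close> columns of \<open>C\<close> are \<open>A\<close> on top of
    zeros.\<close>
  have "M * (C * E) = M * (E * A)"
    using assoc_mult_mat[OF M C E] assoc_mult_mat[OF S M E] assoc_mult_mat[OF M E A]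
    by (simp add: MC ME SM1)
  then have CE: "C * E = E * A"
    using assoc_mult_mat[OF N M] NM C E A by (metis left_mult_one_mat mult_carrier_mat)
  define B where "B = mat k m (\<lambda>(i, j). C $$ (i, j + k))"
  define D where "D = mat m m (\<lambda>(i, j). C $$ (i + k, j + k))"
  have B: "B \<in> carrier_mat k m" and D: "D \<in> carrier_mat m m" by (simp_all add: B_def D_def)
  have C0: "C $$ (i, j) = (if i < k then A $$ (i, j) else 0)" if "i < n" "j < k" for i j
  proof -
    have "C $$ (i, j) = (E * A) $$ (i, j)" using mult_E[OF C that] by (simp add: CE)
    also have "\<dots> = (if i < k then A $$ (i, j) else 0)"
      using that A by (simp add: E_def scalar_prod_def sum.delta if_distrib if_distribR cong: if_cong)
    finally show ?thesis .
  qed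
  have block: "C = four_block_mat A B (0\<^sub>m m k) D"
    by (rule eq_matI) (use A B C D n C0 in \<open>auto simp: B_def D_def\<close>)
  have "similar_mat_wit C S N M"
    using C S N M NM MN unfolding similar_mat_wit_def by (simp add: Let_def C_def)
  then have "char_poly S = char_poly C"
    using char_poly_similar unfolding similar_mat_def by metis
  also have "\<dots> = char_poly A * char_poly D"
    unfolding block by (rule char_poly_four_block_lower_left_zero[OF A B D])
  finally have char: "char_poly S = char_poly A * char_poly D" .
  \<comment> \<open>The columns of \<open>Q\<close> are the members of the basis dual to
    \<open>bs @ cs\<close> that belong to \<open>cs\<close>; they pair to zero with all of
    \<open>bs\<close>.\<close>
  define Q where "Q = N\<^sup>T * F"
  have Q: "Q \<in> carrier_mat n m" using N F by (simp add: Q_def)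
  have MtNt: "M\<^sup>T * N\<^sup>T = 1\<^sub>m n" and NtMt: "N\<^sup>T * M\<^sup>T = 1\<^sub>m n"
    using transpose_mult[OF N M] transpose_mult[OF M N] unfolding NM MN transpose_one
    by metis+
  have Mt: "M\<^sup>T \<in> carrier_mat n n" and Nt: "N\<^sup>T \<in> carrier_mat n n" using M N by auto
  have FF: "F\<^sup>T * F = 1\<^sub>m m"
  proof (rule eq_matI)
    fix i j assume "i < dim_row (1\<^sub>m m :: 'a mat)" "j < dim_col (1\<^sub>m m :: 'a mat)"
    then show "(F\<^sup>T * F) $$ (i, j) = 1\<^sub>m m $$ (i, j)"
      using mult_F[of "F\<^sup>T" m i j] F n by (auto simp: F_def)
  qed (use F in auto)
  have "F\<^sup>T * M\<^sup>T * Q = 1\<^sub>m m"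
  proof -
    have "F\<^sup>T * M\<^sup>T * Q = F\<^sup>T * (M\<^sup>T * Q)" using F Mt Q by (intro assoc_mult_mat) auto
    also have "M\<^sup>T * Q = F"
      unfolding Q_def using assoc_mult_mat[OF Mt Nt F] MtNt F by simp
    finally show ?thesis using FF by simp
  qed
  then have basis: "ordered_basis (col_space Q) (cols Q)"
    using F Mt Q by (intro ordered_basis_cols[of _ m "F\<^sup>T * M\<^sup>T"]) auto
  have perp: "orthogonal_complement U = col_space Q"
  proof -
    have "x \<in> orthogonal_complement U \<longleftrightarrow> (\<exists>c \<in> carrier_vec m. Q *\<^sub>v c = x)"
      if x: "x \<in> carrier_vec n" for x
    proof -
      \<comment> \<open>\<open>y\<close> lists the coordinates of \<open>x\<close> in the dual
        basis, that is, its products with the columns of \<open>M\<close>. Hence \<open>x\<close> is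
        orthogonal to \<open>U\<close> iff the first \<open>k\<close> entries vanish, iff
        \<open>y\<close> is in the range of \<open>F\<close>, iff \<open>x\<close> is in the range
        of \<open>Q\<close>.\<close>
      define y where "y = M\<^sup>T *\<^sub>v x"
      have y: "y \<in> carrier_vec n" using Mt x by (simp add: y_def)
      have xy: "x = N\<^sup>T *\<^sub>v y"
        using assoc_mult_mat_vec[OF Nt Mt x] NtMt x by (simp add: y_def)
      have inj: "N\<^sup>T *\<^sub>v a = N\<^sup>T *\<^sub>v b \<longleftrightarrow> a = b" if "a \<in> carrier_vec n" "b \<in> carrier_vec n" for a b
        using assoc_mult_mat_vec[OF Mt Nt] MtNt that by (metis one_mult_mat_vec)
      have yi: "y $ i = x \<bullet> (bs ! i)" if "i < k" for i
      proof -
        have "col M i = bs ! i"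
          using that ordered_basis_carrier[OF U bs] nth_mem[of i bs]
          by (subst M_def, subst col_mat_of_cols) (auto simp: k_def nth_append)
        moreover have "y $ i = col M i \<bullet> x" using that n M by (simp add: y_def)
        ultimately show ?thesis using x M that n
          by (metis col_dim comm_scalar_prod carrier_matD(1))
      qed
      have "x \<in> orthogonal_complement U \<longleftrightarrow> x \<in> orthogonal_complement (set bs)"
        using bs ordered_basis_iff[OF U] ordered_basis_carrier[OF U bs]
          in_orthogonal_complement_span by metis
      also have "\<dots> \<longleftrightarrow> (\<forall>i < k. y $ i = 0)"
        using x yi by (simp add: orthogonal_complement_def k_def all_set_conv_all_nth)
      also have "\<dots> \<longleftrightarrow> (\<exists>c \<in> carrier_vec m. F *\<^sub>v c = y)"
      proof
        assume 0: "\<forall>i < k. y $ i = 0"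
        have "F *\<^sub>v vec m (\<lambda>j. y $ (j + k)) = y"
        proof (rule eq_vecI)
          fix i assume "i < dim_vec y"
          then have i: "i < n" using y by simp
          \<comment> \<open>For \<open>i < k\<close> the natural number \<open>i - k\<close> is 0, a
            possible index; the guard \<open>k \<le> i\<close> excludes this false match.\<close>
          have "(F *\<^sub>v vec m (\<lambda>j. y $ (j + k))) $ i =
              (\<Sum>j = 0..<m. if j = i - k \<and> k \<le> i then y $ i else 0)"
            using i by (auto simp: F_def scalar_prod_def intro!: sum.cong)
          also have "\<dots> = y $ i" using i n 0 by (cases "k \<le> i") (simp_all add: less_diff_conv2)
          finally show "(F *\<^sub>v vec m (\<lambda>j. y $ (j + k))) $ i = y $ i" .
        qed (use F y in auto)
        then show "\<exists>c \<in> carrier_vec m. F *\<^sub>v c = y" by (intro bexI) auto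
      next
        assume "\<exists>c \<in> carrier_vec m. F *\<^sub>v c = y"
        then show "\<forall>i < k. y $ i = 0" using n by (auto simp: F_def scalar_prod_def)
      qed
      also have "\<dots> \<longleftrightarrow> (\<exists>c \<in> carrier_vec m. Q *\<^sub>v c = x)"
      proof (rule bex_cong[OF refl])
        fix c :: "'a vec" assume c: "c \<in> carrier_vec m"
        have "Q *\<^sub>v c = N\<^sup>T *\<^sub>v (F *\<^sub>v c)" unfolding Q_def by (rule assoc_mult_mat_vec[OF Nt F c])
        then show "F *\<^sub>v c = y \<longleftrightarrow> Q *\<^sub>v c = x"
          using inj[OF mult_mat_vec_carrier[OF F c] y] xy by simp
      qed
      finally show ?thesis .
    qed
    then show ?thesis
      using col_space_eq[OF Q] Q by (auto simp: orthogonal_complement_def)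
  qed
  \<comment> \<open>Transposing moves the zero block to the upper right, so the last
    \<open>m\<close> columns of \<open>C\<^sup>T\<close> are zeros on top of
    \<open>D\<^sup>T\<close>.\<close>
  have CtF: "C\<^sup>T * F = F * D\<^sup>T"
  proof (rule eq_matI)
    fix i j assume "i < dim_row (F * D\<^sup>T)" "j < dim_col (F * D\<^sup>T)"
    then have ij: "i < n" "j < m" using F D by auto
    have "(C\<^sup>T * F) $$ (i, j) = C $$ (j + k, i)" using mult_F[of "C\<^sup>T" n i j] C ij n by simp
    also have "\<dots> = (\<Sum>l = 0..<m. if l = i - k \<and> k \<le> i then D $$ (j, l) else 0)"
      using ij n C0[of "j + k" i] by (cases "k \<le> i") (auto simp: D_def less_diff_conv2)
    also have "\<dots> = (F * D\<^sup>T) $$ (i, j)"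
      using ij D F by (auto simp: F_def scalar_prod_def intro!: sum.cong)
    finally show "(C\<^sup>T * F) $$ (i, j) = (F * D\<^sup>T) $$ (i, j)" .
  qed (use C D F in auto)
  have St: "S\<^sup>T \<in> carrier_mat n n" and Ct: "C\<^sup>T \<in> carrier_mat n n" and Dt: "D\<^sup>T \<in> carrier_mat m m"
    using S C D by auto
  have CN: "C * N = N * S"
    using assoc_mult_mat[OF mult_carrier_mat[OF N S] M N] MN N S by (simp add: C_def)
  have SN: "S\<^sup>T * N\<^sup>T = N\<^sup>T * C\<^sup>T"
    using transpose_mult[OF N S] transpose_mult[OF C N] by (simp add: CN)
  \<comment> \<open>Both sides equal \<open>N\<^sup>T * C\<^sup>T * F\<close>, so
    \<open>D\<^sup>T\<close> represents \<open>S\<^sup>T\<close> on the columns of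
    \<open>Q\<close>.\<close>
  have SQ: "S\<^sup>T * Q = Q * D\<^sup>T"
    unfolding Q_def using assoc_mult_mat[OF St Nt F] assoc_mult_mat[OF Nt Ct F]
      assoc_mult_mat[OF Nt F Dt] by (simp add: SN CtF)
  have sub: "VectorSpace.subspace class_ring (col_space Q) V"
    unfolding col_space_def by (rule span_is_subspace) (use cols_dim Q in blast)
  have "operator_matrix ((*\<^sub>v) S\<^sup>T) (cols Q) D\<^sup>T"
    using operator_matrix_mat_iff[OF sub basis St] Dt Q SQ mat_of_cols_cols[of Q] by simp
  \<comment> \<open>A matrix and its transpose have the same characteristic polynomial, which
    replaces \<open>D\<^sup>T\<close> by \<open>D\<close>.\<close>
  then have "char_poly_on (orthogonal_complement U) ((*\<^sub>v) S\<^sup>T) = char_poly D"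
    using char_poly_on_eq[OF sub St basis] perp D by simp
  then show ?thesis using char char_poly_on_eq[OF U S bs opA] by simp
qed

end

theorem lemma6:
  fixes S :: "'p::prime_card mod_ring mat" and U :: "'p mod_ring vec set" and n :: nat
  assumes "odd CARD('p)"
    and "S \<in> carrier_mat n n"
    and "VectorSpace.subspace class_ring U (module_vec TYPE('p mod_ring) n)"
    and "\<And>v. v \<in> U \<Longrightarrow> S *\<^sub>v v \<in> U"
  shows "(\<forall>v \<in> vec_module.orthogonal_complement n U.
            S\<^sup>T *\<^sub>v v \<in> vec_module.orthogonal_complement n U) \<and>
         char_poly S =
           vec_space.char_poly_on n U ((*\<^sub>v) S) *
           vec_space.char_poly_on n (vec_module.orthogonal_complement n U) ((*\<^sub>v) S\<^sup>T)"
  using vec_space.orthogonal_complement_transpose_invariant[OF assms(2)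
      vec_space.subspace_carrier[OF assms(3)] assms(4)]
    vec_space.char_poly_restrict_orthogonal_complement[OF assms(2-4)]
  by blast

end
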